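(* Let $\mathbb{K}$ be an algebraically closed field of characteristic $0$. Let $\mathcal{A}$ be a unital $\mathbb{K}$-algebra with unit $e_2$ such that on a basis $\{e_i\}_{i=2,\dots,n}$ of $\mathcal{A}$ the multiplication is given by $m(e_i\otimes e_j)=e_{\max(i,j)}$, $i,j=2,\dots,n$. Let $\mathcal{B}$ be the result of adjoining a second unit $e_1=1$ to $\mathcal{A}$. Define linear maps on $\mathcal{B}$ by $$\Delta(e_n)=e_n\otimes e_n,\qquad \Delta(e_i)=(e_i-e_{i+1})\otimes(e_i-e_{i+1})+\Delta(e_{i+1})\quad(i=1,\dots,n-1),$$ $$\varepsilon(e_i)=n-i+1\quad(i=1,\dots,n),\qquad S=\mathrm{id}.$$ Then $\mathcal{B}$ becomes a weak Hopf algebra.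
   Context: Adjoining a unit $e_1$ to $\mathcal{A}$ means forming $\mathcal{B}=\mathcal{A}\oplus\mathbb{K}e_1$ with the multiplication extending that of $\mathcal{A}$ for which $e_1$ is the unit. Weak bialgebra. Write $xy=m(x\otimes y)$ and use Sweedler notation $\Delta(x)=x_{(1)}\otimes x_{(2)}$ (summation understood). A weak bialgebra is a quintuple $(V,m,\eta,\Delta,\varepsilon)$ with linear maps $m:V\otimes V\to V$, $\eta:\mathbb{K}\to V$ (write $1=\eta(1)$), $\Delta:V\to V\otimes V$, $\varepsilon:V\to\mathbb{K}$ such that: (1) $(V,m,\eta)$ is a unital associative algebra; (2) $(V,\Delta,\varepsilon)$ is a coassociative counital coalgebra; (3) for all $x,y,z\in V$: $\Delta(xy)=\Delta(x)\bullet\Delta(y)$; $(\Delta\otimes \mathrm{id})\Delta(1)=(\Delta(1)\otimes 1)\bullet(1\otimes\Delta(1))=(1\otimes\Delta(1))\bullet(\Delta(1)\otimes 1)$; and $\varepsilon(xyz)=\varepsilon(xy_{(1)})\,\varepsilon(y_{(2)}z)$. Here $\bullet$ is the usual componentwise multiplication on tensor powers of $V$. Weak Hopf algebra: a weak bialgebra together with a linear endomorphism $S$ of $V$ (antipode) such that for all $x\in V$: $m(\mathrm{id}\otimes S)\Delta(x)=(\varepsilon\otimes \mathrm{id})(\Delta(1)\bullet(x\otimes 1))$; $m(S\otimes \mathrm{id})\Delta(x)=(\mathrm{id}\otimes\varepsilon)((1\otimes x)\bullet\Delta(1))$; $m(m\otimes \mathrm{id})(S\otimes \mathrm{id}\otimes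 S)(\Delta\otimes \mathrm{id})\Delta(x)=S(x)$. *)

theory Defs
  imports
    "HOL-Computational_Algebra.Polynomial"
    "HOL-Library.Poly_Mapping"
    "HOL-Library.Product_Plus"
begin

section \<open>Tensor powers of a vector space\<close>

text \<open>
  For a vector space \<open>V\<close> over \<open>\<bbbK>\<close>, the tensor powers are built in the usual way: the free vector
  space on the tuples of length \<open>k\<close>, modulo the subspace generated by the multilinearity relations,
  is \<open>V\<^sup>\<otimes>\<^sup>k\<close>. All powers are treated at once by using lists as tuples, so that \<open>V\<^sup>\<otimes>\<^sup>0 = \<bbbK>\<close>
  (spanned by the empty list), \<open>V\<^sup>\<otimes>\<^sup>1 = V\<close>, and the associativity and unit isomorphisms of the
  tensor product are identities. Elements of the quotient are handled through representatives:
  equality in a tensor power is the congruence \<open>tensor_eq\<close>, never equality of representatives.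
\<close>

type_synonym ('v, 'k) formal_tensor = "'v list \<Rightarrow>\<^sub>0 'k"

definition fscale :: "'k::field \<Rightarrow> ('b \<Rightarrow>\<^sub>0 'k) \<Rightarrow> 'b \<Rightarrow>\<^sub>0 'k" where
  "fscale c p = Poly_Mapping.map ((*) c) p"

lemma lookup_fscale: "Poly_Mapping.lookup (fscale c p) w = c * Poly_Mapping.lookup p w"
  by (simp add: fscale_def Poly_Mapping.map.rep_eq when_def)

interpretation formal: vector_space fscale
  by unfold_locales
    (auto intro!: poly_mapping_eqI simp: lookup_fscale lookup_add algebra_simps)

definition pure :: "'v list \<Rightarrow> ('v, 'k::field) formal_tensor" where
  "pure w = Poly_Mapping.single w 1"

definition tensors :: "nat \<Rightarrow> ('v, 'k::field) formal_tensor set" where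
  "tensors k = {p. \<forall>w\<in>Poly_Mapping.keys p. length w = k}"

definition tensor_relations ::
  "('k::field \<Rightarrow> 'v::ab_group_add \<Rightarrow> 'v) \<Rightarrow> ('v, 'k) formal_tensor set" where
  "tensor_relations scale =
     {pure (us @ [x + y] @ vs) - pure (us @ [x] @ vs) - pure (us @ [y] @ vs) | us vs x y. True}
     \<union> {pure (us @ [scale c x] @ vs) - fscale c (pure (us @ [x] @ vs)) | us vs c x. True}"

definition tensor_eq ::
  "('k::field \<Rightarrow> 'v::ab_group_add \<Rightarrow> 'v) \<Rightarrow> ('v, 'k) formal_tensor \<Rightarrow> ('v, 'k) formal_tensor \<Rightarrow> bool"
  where "tensor_eq scale p q \<longleftrightarrow> p - q \<in> formal.span (tensor_relations scale)"

text \<open>Linear extension of a map given on the basis of a free vector space.\<close>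

definition lin_ext :: "('b \<Rightarrow> ('c \<Rightarrow>\<^sub>0 'k::field)) \<Rightarrow> ('b \<Rightarrow>\<^sub>0 'k) \<Rightarrow> 'c \<Rightarrow>\<^sub>0 'k" where
  "lin_ext f p = (\<Sum>w\<in>Poly_Mapping.keys p. fscale (Poly_Mapping.lookup p w) (f w))"

definition tensor_prod ::
  "('v, 'k::field) formal_tensor \<Rightarrow> ('v, 'k) formal_tensor \<Rightarrow> ('v, 'k) formal_tensor"
  (infixr \<open>\<otimes>\<close> 75) where
  "p \<otimes> q = lin_ext (\<lambda>u. lin_ext (\<lambda>w. pure (u @ w)) q) p"

text \<open>
  Componentwise multiplication \<open>(x\<^sub>1 \<otimes> \<dots> \<otimes> x\<^sub>k) \<bullet> (y\<^sub>1 \<otimes> \<dots> \<otimes> y\<^sub>k) = x\<^sub>1y\<^sub>1 \<otimes> \<dots> \<otimes> x\<^sub>ky\<^sub>k\<close>;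
  it is only meant for two arguments of the same degree.
\<close>

definition cw_mult ::
  "('v \<Rightarrow> 'v \<Rightarrow> 'v) \<Rightarrow> ('v, 'k::field) formal_tensor \<Rightarrow> ('v, 'k) formal_tensor \<Rightarrow> ('v, 'k) formal_tensor"
  where "cw_mult mul p q = lin_ext (\<lambda>u. lin_ext (\<lambda>w. pure (map2 mul u w)) q) p"

text \<open>
  \<open>map_tensor a f g\<close> is \<open>f \<otimes> g\<close>, where \<open>f\<close> acts on the first \<open>a\<close> tensor factors and \<open>g\<close> on the
  remaining ones.
\<close>

definition map_tensor ::
  "nat \<Rightarrow> (('v, 'k::field) formal_tensor \<Rightarrow> ('v, 'k) formal_tensor)
   \<Rightarrow> (('v, 'k) formal_tensor \<Rightarrow> ('v, 'k) formal_tensor)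
   \<Rightarrow> ('v, 'k) formal_tensor \<Rightarrow> ('v, 'k) formal_tensor" where
  "map_tensor a f g = lin_ext (\<lambda>w. f (pure (take a w)) \<otimes> g (pure (drop a w)))"

text \<open>
  The structure maps \<open>m : V \<otimes> V \<rightarrow> V\<close>, \<open>\<Delta> : V \<rightarrow> V \<otimes> V\<close>, \<open>\<epsilon> : V \<rightarrow> \<bbbK>\<close> and \<open>S : V \<rightarrow> V\<close> as maps
  between tensor powers, so that they can be combined by \<open>map_tensor\<close>. Each is applied only in
  the degree of its domain.
\<close>

definition mult_op where
  "mult_op mul = (lin_ext (\<lambda>w. pure [mul (w ! 0) (w ! 1)]) ::
     ('v, 'k::field) formal_tensor \<Rightarrow> ('v, 'k) formal_tensor)"

definition comult_op where
  "comult_op \<Delta> = (lin_ext (\<lambda>w. \<Delta> (w ! 0)) ::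
     ('v, 'k::field) formal_tensor \<Rightarrow> ('v, 'k) formal_tensor)"

definition counit_op where
  "counit_op \<epsilon> = (lin_ext (\<lambda>w. Poly_Mapping.single [] (\<epsilon> (w ! 0))) ::
     ('v, 'k::field) formal_tensor \<Rightarrow> ('v, 'k) formal_tensor)"

definition endo_op where
  "endo_op S = (lin_ext (\<lambda>w. pure [S (w ! 0)]) ::
     ('v, 'k::field) formal_tensor \<Rightarrow> ('v, 'k) formal_tensor)"

text \<open>A linear map \<open>V \<rightarrow> V\<^sup>\<otimes>\<^sup>k\<close>, given by a choice of representatives of its values.\<close>

definition linear_to_tensors ::
  "('k::field \<Rightarrow> 'v::ab_group_add \<Rightarrow> 'v) \<Rightarrow> nat \<Rightarrow> ('v \<Rightarrow> ('v, 'k) formal_tensor) \<Rightarrow> bool" where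
  "linear_to_tensors scale k f \<longleftrightarrow>
     (\<forall>x. f x \<in> tensors k)
     \<and> (\<forall>x y. tensor_eq scale (f (x + y)) (f x + f y))
     \<and> (\<forall>c x. tensor_eq scale (f (scale c x)) (fscale c (f x)))"

context vector_space
begin

abbreviation teq (infix \<open>\<approx>\<close> 50) where
  "p \<approx> q \<equiv> tensor_eq scale p q"

end

text \<open>
  In degree one the congruence is equality in \<open>V\<close>, as it must be for \<open>V\<^sup>\<otimes>\<^sup>1 = V\<close>. The map \<open>\<phi>\<close> below
  evaluates the degree-one part of a formal tensor in \<open>V\<close>.
\<close>

lemma (in vector_space) teq_pure_singleton: "pure [x] \<approx> pure [y] \<longleftrightarrow> x = y"
proof
  define \<phi> where "\<phi> p = (\<Sum>w\<in>Poly_Mapping.keys p.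
    if length w = 1 then scale (Poly_Mapping.lookup p w) (w ! 0) else 0)" for p :: "('b, 'a) formal_tensor"
  have ext: "\<phi> p = (\<Sum>w\<in>A. if length w = 1 then scale (Poly_Mapping.lookup p w) (w ! 0) else 0)"
    if "finite A" "Poly_Mapping.keys p \<subseteq> A" for A p
    unfolding \<phi>_def by (rule sum.mono_neutral_left) (use that in \<open>auto simp: in_keys_iff\<close>)
  have add: "\<phi> (p + q) = \<phi> p + \<phi> q" for p q
  proof -
    let ?A = "Poly_Mapping.keys p \<union> Poly_Mapping.keys q \<union> Poly_Mapping.keys (p + q)"
    have "\<phi> p + \<phi> q = (\<Sum>w\<in>?A. (if length w = 1 then scale (Poly_Mapping.lookup p w) (w ! 0) else 0)
       + (if length w = 1 then scale (Poly_Mapping.lookup q w) (w ! 0) else 0))"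
      unfolding sum.distrib by (intro arg_cong2[where f = "(+)"] ext) auto
    also have "\<dots> = (\<Sum>w\<in>?A. if length w = 1 then scale (Poly_Mapping.lookup (p+q) w) (w ! 0) else 0)"
      by (rule sum.cong) (auto simp: lookup_add scale_left_distrib)
    also have "\<dots> = \<phi> (p + q)" by (rule ext[symmetric]) auto
    finally show ?thesis by simp
  qed
  have sc: "\<phi> (fscale c p) = scale c (\<phi> p)" for c p
  proof -
    have "\<phi> (fscale c p) = (\<Sum>w\<in>Poly_Mapping.keys p. if length w = 1 then scale (Poly_Mapping.lookup (fscale c p) w) (w ! 0) else 0)"
      by (rule ext) (auto simp: in_keys_iff lookup_fscale)
    then show ?thesis by (simp add: lookup_fscale \<phi>_def scale_sum_right if_distrib cong: if_cong)
  qed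
  have lin: "Vector_Spaces.linear fscale scale \<phi>"
    by (simp add: Vector_Spaces.linear_def module_hom_def module_hom_axioms_def add sc
        formal.vector_space_axioms vector_space_axioms formal.module_axioms module_axioms)
  then interpret L: Vector_Spaces.linear fscale scale \<phi> .
  have pure: "\<phi> (pure w) = (if length w = 1 then w ! 0 else 0)" for w
    by (simp add: \<phi>_def pure_def)
  have rel: "\<phi> r = 0" if "r \<in> tensor_relations scale" for r
    using that unfolding tensor_relations_def
    by (auto simp: L.diff L.scale pure nth_append)
  assume "pure [x] \<approx> pure [y]"
  then have "pure [x] - pure [y] \<in> formal.span (tensor_relations scale)"
    by (simp add: tensor_eq_def)
  then have "\<phi> (pure [x] - pure [y]) = 0"
    by (rule L.eq_0_on_span[rotated]) (rule rel)
  then show "x = y" by (simp add: L.diff pure)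
qed (simp add: tensor_eq_def formal.span_zero)


section \<open>Weak Hopf algebras\<close>

locale unital_algebra = vector_space scale
  for scale :: "'k::field \<Rightarrow> 'v::ab_group_add \<Rightarrow> 'v" +
  fixes mul :: "'v \<Rightarrow> 'v \<Rightarrow> 'v" and one :: 'v
  assumes mult_linear_right: "Vector_Spaces.linear scale scale (\<lambda>y. mul x y)"
    and mult_linear_left: "Vector_Spaces.linear scale scale (\<lambda>x. mul x y)"
    and mult_assoc: "mul (mul x y) z = mul x (mul y z)"
    and mult_one_left: "mul one x = x"
    and mult_one_right: "mul x one = x"

locale coalgebra = vector_space scale
  for scale :: "'k::field \<Rightarrow> 'v::ab_group_add \<Rightarrow> 'v" +
  fixes \<Delta> :: "'v \<Rightarrow> ('v, 'k) formal_tensor" and \<epsilon> :: "'v \<Rightarrow> 'k"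
  assumes comult_linear: "linear_to_tensors scale 2 \<Delta>"
    and counit_linear: "Vector_Spaces.linear scale (*) \<epsilon>"
    and coassoc:
      "map_tensor 1 (comult_op \<Delta>) id (\<Delta> x) \<approx> map_tensor 1 id (comult_op \<Delta>) (\<Delta> x)"
    and counit_left: "map_tensor 1 (counit_op \<epsilon>) id (\<Delta> x) \<approx> pure [x]"
    and counit_right: "map_tensor 1 id (counit_op \<epsilon>) (\<Delta> x) \<approx> pure [x]"

text \<open>
  In \<open>counit_mult\<close> a word \<open>w\<close> of \<open>\<Delta>(y)\<close> is \<open>y\<^sub>(\<^sub>1\<^sub>) \<otimes> y\<^sub>(\<^sub>2\<^sub>)\<close>, and the sum is the Sweedler
  summation for \<open>\<epsilon>(xy\<^sub>(\<^sub>1\<^sub>)) \<epsilon>(y\<^sub>(\<^sub>2\<^sub>)z)\<close>.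
\<close>

locale weak_bialgebra =
  unital_algebra scale mul "\<eta> 1" + coalgebra scale \<Delta> \<epsilon>
  for scale :: "'k::field \<Rightarrow> 'v::ab_group_add \<Rightarrow> 'v"
    and mul :: "'v \<Rightarrow> 'v \<Rightarrow> 'v" and \<eta> :: "'k \<Rightarrow> 'v"
    and \<Delta> :: "'v \<Rightarrow> ('v, 'k) formal_tensor" and \<epsilon> :: "'v \<Rightarrow> 'k" +
  assumes unit_linear: "Vector_Spaces.linear (*) scale \<eta>"
    and comult_mult: "\<Delta> (mul x y) \<approx> cw_mult mul (\<Delta> x) (\<Delta> y)"
    and comult_one_1: "map_tensor 1 (comult_op \<Delta>) id (\<Delta> (\<eta> 1)) \<approx>
      cw_mult mul (\<Delta> (\<eta> 1) \<otimes> pure [\<eta> 1]) (pure [\<eta> 1] \<otimes> \<Delta> (\<eta> 1))"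
    and comult_one_2: "map_tensor 1 (comult_op \<Delta>) id (\<Delta> (\<eta> 1)) \<approx>
      cw_mult mul (pure [\<eta> 1] \<otimes> \<Delta> (\<eta> 1)) (\<Delta> (\<eta> 1) \<otimes> pure [\<eta> 1])"
    and counit_mult: "\<epsilon> (mul (mul x y) z) =
      (\<Sum>w\<in>Poly_Mapping.keys (\<Delta> y).
         Poly_Mapping.lookup (\<Delta> y) w * (\<epsilon> (mul x (w ! 0)) * \<epsilon> (mul (w ! 1) z)))"

locale weak_hopf_algebra = weak_bialgebra scale mul \<eta> \<Delta> \<epsilon>
  for scale :: "'k::field \<Rightarrow> 'v::ab_group_add \<Rightarrow> 'v"
    and mul :: "'v \<Rightarrow> 'v \<Rightarrow> 'v" and \<eta> :: "'k \<Rightarrow> 'v"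
    and \<Delta> :: "'v \<Rightarrow> ('v, 'k) formal_tensor" and \<epsilon> :: "'v \<Rightarrow> 'k" +
  fixes S :: "'v \<Rightarrow> 'v"
  assumes antipode_linear: "Vector_Spaces.linear scale scale S"
    and antipode_right: "mult_op mul (map_tensor 1 id (endo_op S) (\<Delta> x)) \<approx>
      map_tensor 1 (counit_op \<epsilon>) id (cw_mult mul (\<Delta> (\<eta> 1)) (pure [x] \<otimes> pure [\<eta> 1]))"
    and antipode_left: "mult_op mul (map_tensor 1 (endo_op S) id (\<Delta> x)) \<approx>
      map_tensor 1 id (counit_op \<epsilon>) (cw_mult mul (pure [\<eta> 1] \<otimes> pure [x]) (\<Delta> (\<eta> 1)))"
    and antipode_antipode:
      "mult_op mul (map_tensor 2 (mult_op mul) id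
         (map_tensor 1 (endo_op S) (map_tensor 1 id (endo_op S))
           (map_tensor 1 (comult_op \<Delta>) id (\<Delta> x)))) \<approx> pure [S x]"


section \<open>Adjoining a unit\<close>

text \<open>The pair \<open>(a, \<alpha>)\<close> stands for \<open>a + \<alpha> e\<^sub>1\<close> in \<open>\<A> \<oplus> \<bbbK>e\<^sub>1\<close>.\<close>

definition adjoin_scale ::
  "('k::field \<Rightarrow> 'a::ab_group_add \<Rightarrow> 'a) \<Rightarrow> 'k \<Rightarrow> 'a \<times> 'k \<Rightarrow> 'a \<times> 'k" where
  "adjoin_scale scale = (\<lambda>c (a, \<alpha>). (scale c a, c * \<alpha>))"

definition adjoin_mult ::
  "('k::field \<Rightarrow> 'a::ab_group_add \<Rightarrow> 'a) \<Rightarrow> ('a \<Rightarrow> 'a \<Rightarrow> 'a) \<Rightarrow> 'a \<times> 'k \<Rightarrow> 'a \<times> 'k \<Rightarrow> 'a \<times> 'k" where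
  "adjoin_mult scale mul =
     (\<lambda>(a, \<alpha>) (b, \<beta>). (mul a b + scale \<alpha> b + scale \<beta> a, \<alpha> * \<beta>))"

definition adjoin_basis :: "(nat \<Rightarrow> 'a::ab_group_add) \<Rightarrow> nat \<Rightarrow> 'a \<times> 'k::field" where
  "adjoin_basis e i = (if i = 1 then (0, 1) else (e i, 0))"

end

theory Submission
  imports Defs
begin

text \<open>
  The telescoping definition of \<open>\<Delta>\<close> points at the right basis. Put \<open>f\<^sub>i = e\<^sub>i - e\<^sub>i\<^sub>+\<^sub>1\<close> for \<open>i < n\<close> and
  \<open>f\<^sub>n = e\<^sub>n\<close>. The rule \<open>e\<^sub>i e\<^sub>j = e\<^bsub>max(i,j)\<^esub>\<close> says that the \<open>f\<^sub>i\<close> are orthogonal idempotents with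
  sum \<open>e\<^sub>1 = 1\<close>, so \<open>\<B>\<close> is the algebra \<open>\<bbbK>\<^sup>n\<close>; moreover \<open>\<Delta>(f\<^sub>i) = f\<^sub>i \<otimes> f\<^sub>i\<close> and \<open>\<epsilon>(f\<^sub>i) = 1\<close>. For such a
  structure every axiom of a weak Hopf algebra with \<open>S = id\<close> is immediate on the \<open>f\<^sub>i\<close>: it is the
  category algebra of a discrete category with \<open>n\<close> objects.

  The proof works with the coordinate functionals \<open>\<phi>\<^sub>i\<close> of the basis \<open>f\<close>, which are characters of
  the algebra. Their tensor products \<open>\<phi>\<^bsub>i(1)\<^esub> \<otimes> \<dots> \<otimes> \<phi>\<^bsub>i(k)\<^esub>\<close> are defined on representatives and detect
  equality in every tensor power (\<open>teq_iff_coords\<close>). Each axiom between tensors thereby becomes an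
  identity of scalars, computed on representatives. These identities follow from three facts: componentwise multiplication multiplies
  coordinates, \<open>(\<phi>\<^sub>i \<otimes> \<phi>\<^sub>j)\<Delta>\<close> is \<open>\<phi>\<^sub>i\<close> if \<open>i = j\<close> and \<open>0\<close> otherwise, and \<open>\<epsilon>\<close> is the sum of the
  \<open>\<phi>\<^sub>i\<close> (\<open>diagonal_coproduct_weak_hopf_algebra\<close>). For \<open>\<B>\<close> itself, \<open>\<phi>\<^sub>i\<close> is the linear functional
  with \<open>\<phi>\<^sub>i(e\<^sub>j) = 1\<close> for \<open>j \<le> i\<close> and \<open>0\<close> for \<open>j > i\<close>.
\<close>

section \<open>Linear functionals on formal tensors\<close>

definition pairing :: "('b \<Rightarrow> 'k::field) \<Rightarrow> ('b \<Rightarrow>\<^sub>0 'k) \<Rightarrow> 'k" where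
  "pairing g p = (\<Sum>w\<in>Poly_Mapping.keys p. Poly_Mapping.lookup p w * g w)"

lemma pairing_superset:
  assumes "finite A" "Poly_Mapping.keys p \<subseteq> A"
  shows "pairing g p = (\<Sum>w\<in>A. Poly_Mapping.lookup p w * g w)"
  unfolding pairing_def
  by (rule sum.mono_neutral_left) (use assms in \<open>auto simp: in_keys_iff\<close>)

lemma pairing_zero [simp]: "pairing g 0 = 0"
  by (simp add: pairing_def)

lemma pairing_add: "pairing g (p + q) = pairing g p + pairing g q"
proof -
  let ?A = "Poly_Mapping.keys p \<union> Poly_Mapping.keys q"
  have "Poly_Mapping.keys (p + q) \<subseteq> ?A"
    by (rule Poly_Mapping.keys_add)
  then show ?thesis
    by (simp add: pairing_superset[of ?A] lookup_add distrib_right sum.distrib)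
qed

lemma pairing_fscale: "pairing g (fscale c p) = c * pairing g p"
proof -
  have "Poly_Mapping.keys (fscale c p) \<subseteq> Poly_Mapping.keys p"
    by (auto simp: in_keys_iff lookup_fscale)
  then show ?thesis
    by (simp add: pairing_superset[of "Poly_Mapping.keys p"] lookup_fscale sum_distrib_left
        mult.assoc)
qed

lemma pairing_diff: "pairing g (p - q) = pairing g p - pairing g q"
  using pairing_add[of g "p - q" q] by (simp add: algebra_simps)

lemma pairing_sum: "pairing g (\<Sum>a\<in>A. h a) = (\<Sum>a\<in>A. pairing g (h a))"
  by (induction A rule: infinite_finite_induct) (simp_all add: pairing_add)

lemma pairing_pure [simp]: "pairing g (pure w) = g w"
  by (simp add: pairing_def pure_def)

lemma pairing_single [simp]: "pairing g (Poly_Mapping.single w c) = c * g w"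
  by (simp add: pairing_def)

lemma pairing_cong:
  assumes "\<And>w. w \<in> Poly_Mapping.keys p \<Longrightarrow> g w = h w"
  shows "pairing g p = pairing h p"
  using assms by (simp add: pairing_def)

lemma pairing_times_left: "pairing (\<lambda>w. c * g w) p = c * pairing g p"
  by (simp add: pairing_def sum_distrib_left mult.left_commute)

lemma pairing_times_right: "pairing (\<lambda>w. g w * c) p = pairing g p * c"
  by (simp add: pairing_def sum_distrib_right mult.assoc)

lemma pairing_sum_functional: "pairing (\<lambda>w. \<Sum>a\<in>A. g a w) p = (\<Sum>a\<in>A. pairing (g a) p)"
  unfolding pairing_def sum_distrib_left by (rule sum.swap)

lemma pairing_zero_functional [simp]: "pairing (\<lambda>w. 0) p = 0"
  by (simp add: pairing_def)

lemma pairing_if_times: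
  "pairing (\<lambda>w. (if c then g w else 0) * h w) p = (if c then pairing (\<lambda>w. g w * h w) p else 0)"
  "pairing (\<lambda>w. h w * (if c then g w else 0)) p = (if c then pairing (\<lambda>w. h w * g w) p else 0)"
  by simp_all

text \<open>
  A functional applied to a linearly extended map is again a functional given on words. Applied
  repeatedly, this evaluates composites of \<open>map_tensor\<close>, \<open>comult_op\<close> and the other operations.
\<close>

lemma pairing_lin_ext: "pairing g (lin_ext F p) = pairing (\<lambda>w. pairing g (F w)) p"
  by (simp add: lin_ext_def pairing_sum pairing_fscale) (simp add: pairing_def)

lemma lin_ext_pure [simp]: "lin_ext F (pure w) = F w"
  by (simp add: lin_ext_def pure_def)

lemma formal_tensor_expansion:
  "p = (\<Sum>w\<in>Poly_Mapping.keys p. fscale (Poly_Mapping.lookup p w) (pure w))"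
  by (rule poly_mapping_eqI)
    (simp add: lookup_sum lookup_fscale pure_def lookup_single when_def in_keys_iff
      if_distrib cong: if_cong)

lemma pure_tensor_prod [simp]: "pure u \<otimes> pure w = pure (u @ w)"
  by (simp add: tensor_prod_def)

lemma pure_in_tensors [simp]: "pure w \<in> tensors k \<longleftrightarrow> length w = k"
  by (simp add: pure_def tensors_def)

lemma length_of_tensor_word: "p \<in> tensors k \<Longrightarrow> w \<in> Poly_Mapping.keys p \<Longrightarrow> length w = k"
  by (simp add: tensors_def)

lemma lin_ext_eq_self:
  assumes "\<And>w. w \<in> Poly_Mapping.keys p \<Longrightarrow> F w = pure w"
  shows "lin_ext F p = p"
proof -
  have "lin_ext F p = (\<Sum>w\<in>Poly_Mapping.keys p. fscale (Poly_Mapping.lookup p w) (pure w))"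
    unfolding lin_ext_def by (rule sum.cong) (simp_all add: assms)
  then show ?thesis by (simp only: formal_tensor_expansion[symmetric])
qed

lemma lin_ext_in_tensors:
  assumes "\<And>w. w \<in> Poly_Mapping.keys p \<Longrightarrow> F w \<in> tensors k"
  shows "lin_ext F p \<in> tensors k"
  unfolding tensors_def
proof (intro CollectI ballI)
  fix v assume "v \<in> Poly_Mapping.keys (lin_ext F p)"
  then have "(\<Sum>w\<in>Poly_Mapping.keys p. Poly_Mapping.lookup p w * Poly_Mapping.lookup (F w) v) \<noteq> 0"
    by (simp add: lin_ext_def in_keys_iff lookup_sum lookup_fscale)
  then obtain w where "w \<in> Poly_Mapping.keys p" "Poly_Mapping.lookup (F w) v \<noteq> 0"
    by (metis (no_types, lifting) mult_zero_right sum.neutral)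
  then show "length v = k"
    using length_of_tensor_word[OF assms] by (simp add: in_keys_iff)
qed

lemma tensor_prod_in_tensors [simp]:
  assumes "p \<in> tensors a" "q \<in> tensors b"
  shows "p \<otimes> q \<in> tensors (a + b)"
  unfolding tensor_prod_def
  by (intro lin_ext_in_tensors)
    (simp add: length_of_tensor_word[OF assms(1)] length_of_tensor_word[OF assms(2)])

lemma cw_mult_in_tensors:
  assumes "p \<in> tensors k" "q \<in> tensors k"
  shows "cw_mult mul p q \<in> tensors k"
  unfolding cw_mult_def
  by (intro lin_ext_in_tensors)
    (simp add: length_of_tensor_word[OF assms(1)] length_of_tensor_word[OF assms(2)])

lemma map_tensor_in_tensors:
  assumes "p \<in> tensors k" "a \<le> k"
    and "\<And>w. length w = a \<Longrightarrow> f (pure w) \<in> tensors b"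
    and "\<And>w. length w = k - a \<Longrightarrow> g (pure w) \<in> tensors c"
  shows "map_tensor a f g p \<in> tensors (b + c)"
  unfolding map_tensor_def
  by (intro lin_ext_in_tensors tensor_prod_in_tensors assms(3,4))
    (use assms(2) length_of_tensor_word[OF assms(1)] in auto)

lemma map_tensor_endo_id:
  assumes "p \<in> tensors 2"
  shows "map_tensor 1 id (endo_op id) p = p" "map_tensor 1 (endo_op id) id p = p"
proof -
  show "map_tensor 1 id (endo_op id) p = p" "map_tensor 1 (endo_op id) id p = p"
    unfolding map_tensor_def
    by (rule lin_ext_eq_self, drule length_of_tensor_word[OF assms],
        auto simp: endo_op_def length_Suc_conv numeral_2_eq_2)+
qed

lemma map_tensor_endo_id3:
  assumes "p \<in> tensors 3"
  shows "map_tensor 1 (endo_op id) (map_tensor 1 id (endo_op id)) p = p"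
  unfolding map_tensor_def
  by (rule lin_ext_eq_self, drule length_of_tensor_word[OF assms])
    (auto simp: endo_op_def length_Suc_conv numeral_3_eq_3)

section \<open>Coordinates on tensor powers\<close>

text \<open>
  The functional \<open>\<phi>\<^bsub>J(1)\<^esub> \<otimes> \<dots> \<otimes> \<phi>\<^bsub>J(k)\<^esub>\<close> on words. Making it vanish on words of any other length
  lets these functionals separate tensors of mixed degree as well.
\<close>

fun word_value :: "('i \<Rightarrow> 'v \<Rightarrow> 'k::field) \<Rightarrow> 'i list \<Rightarrow> 'v list \<Rightarrow> 'k" where
  "word_value \<phi> [] [] = 1"
| "word_value \<phi> (i # J) (v # w) = \<phi> i v * word_value \<phi> J w"
| "word_value \<phi> _ _ = 0"

lemma word_value_Nil [simp]: "word_value \<phi> J [] = (if J = [] then 1 else 0)"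
  by (cases J) auto

lemma word_value_length: "length J \<noteq> length w \<Longrightarrow> word_value \<phi> J w = 0"
  by (induction \<phi> J w rule: word_value.induct) auto

lemma word_value_append:
  "word_value \<phi> J (u @ w) = word_value \<phi> (take (length u) J) u * word_value \<phi> (drop (length u) J) w"
proof (induction u arbitrary: J)
  case (Cons v u)
  then show ?case by (cases J) simp_all
qed simp

text \<open>
  A tensor product of characters is a character of the tensor power. The lengths must agree
  because \<open>map2\<close> truncates the longer word.
\<close>

lemma word_value_map2:
  assumes "\<And>i x y. i \<in> set J \<Longrightarrow> \<phi> i (mul x y) = \<phi> i x * \<phi> i y" "length u = length w"
  shows "word_value \<phi> J (map2 mul u w) = word_value \<phi> J u * word_value \<phi> J w"
  using assms(2,1)
proof (induction u w arbitrary: J rule: list_induct2)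
  case (Cons x u y w)
  show ?case
  proof (cases J)
    case (Cons i K)
    then show ?thesis using Cons.IH[of K] Cons.prems by simp
  qed simp
qed simp

abbreviation tensor_coord :: "('i \<Rightarrow> 'v \<Rightarrow> 'k::field) \<Rightarrow> 'i list \<Rightarrow> ('v, 'k) formal_tensor \<Rightarrow> 'k" where
  "tensor_coord \<phi> J \<equiv> pairing (word_value \<phi> J)"

lemma tensor_coord_degree:
  assumes "p \<in> tensors k" "length J \<noteq> k"
  shows "tensor_coord \<phi> J p = 0"
proof -
  have "tensor_coord \<phi> J p = pairing (\<lambda>w. 0) p"
    by (rule pairing_cong) (use assms in \<open>auto dest: length_of_tensor_word simp: word_value_length\<close>)
  then show ?thesis by simp
qed

lemma tensor_coord_tensor_prod:
  assumes "p \<in> tensors a"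
  shows "tensor_coord \<phi> J (p \<otimes> q) = tensor_coord \<phi> (take a J) p * tensor_coord \<phi> (drop a J) q"
proof -
  have "tensor_coord \<phi> J (p \<otimes> q)
      = pairing (\<lambda>u. word_value \<phi> (take a J) u * tensor_coord \<phi> (drop a J) q) p"
    unfolding tensor_prod_def pairing_lin_ext
    by (rule pairing_cong)
      (simp add: word_value_append length_of_tensor_word[OF assms] pairing_times_left)
  then show ?thesis by (simp add: pairing_times_right)
qed

lemma tensor_coord_cw_mult:
  assumes "\<And>i x y. i \<in> set J \<Longrightarrow> \<phi> i (mul x y) = \<phi> i x * \<phi> i y"
    and "p \<in> tensors k" "q \<in> tensors k"
  shows "tensor_coord \<phi> J (cw_mult mul p q) = tensor_coord \<phi> J p * tensor_coord \<phi> J q"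
proof -
  have "tensor_coord \<phi> J (cw_mult mul p q) = pairing (\<lambda>u. word_value \<phi> J u * tensor_coord \<phi> J q) p"
    unfolding cw_mult_def pairing_lin_ext
  proof (rule pairing_cong)
    fix u assume u: "u \<in> Poly_Mapping.keys p"
    have "pairing (\<lambda>w. tensor_coord \<phi> J (pure (map2 mul u w))) q
        = pairing (\<lambda>w. word_value \<phi> J u * word_value \<phi> J w) q"
      by (rule pairing_cong)
        (use assms u in \<open>simp add: word_value_map2 length_of_tensor_word[of _ k]\<close>)
    then show "pairing (\<lambda>w. tensor_coord \<phi> J (pure (map2 mul u w))) q
        = word_value \<phi> J u * tensor_coord \<phi> J q"
      by (simp add: pairing_times_left)
  qed
  then show ?thesis by (simp add: pairing_times_right)
qed

text \<open>For a character \<open>\<phi>\<close> one has \<open>\<phi> \<circ> m = \<phi> \<otimes> \<phi>\<close>.\<close>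

lemma tensor_coord_mult_op:
  assumes "\<And>i x y. i \<in> set J \<Longrightarrow> \<phi> i (mul x y) = \<phi> i x * \<phi> i y" "p \<in> tensors 2"
  shows "tensor_coord \<phi> J (mult_op mul p) = (case J of [i] \<Rightarrow> tensor_coord \<phi> [i, i] p | _ \<Rightarrow> 0)"
proof -
  have "tensor_coord \<phi> J (mult_op mul p)
      = pairing (\<lambda>w. case J of [i] \<Rightarrow> word_value \<phi> [i, i] w | _ \<Rightarrow> 0) p"
    unfolding mult_op_def pairing_lin_ext
  proof (rule pairing_cong)
    fix w assume "w \<in> Poly_Mapping.keys p"
    then have "length w = 2" using assms(2) by (rule length_of_tensor_word[rotated])
    then obtain x y where "w = [x, y]"
      by (auto simp: length_Suc_conv numeral_2_eq_2)
    then show "tensor_coord \<phi> J (pure [mul (w ! 0) (w ! 1)])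
        = (case J of [i] \<Rightarrow> word_value \<phi> [i, i] w | _ \<Rightarrow> 0)"
      using assms(1) by (auto split: list.split)
  qed
  then show ?thesis by (simp split: list.split)
qed

lemma tensor_coord_map_tensor:
  assumes "p \<in> tensors k" "a \<le> k" "\<And>w. length w = a \<Longrightarrow> f (pure w) \<in> tensors b"
  shows "tensor_coord \<phi> J (map_tensor a f g p) =
    pairing (\<lambda>w. tensor_coord \<phi> (take b J) (f (pure (take a w)))
      * tensor_coord \<phi> (drop b J) (g (pure (drop a w)))) p"
  unfolding map_tensor_def pairing_lin_ext
  by (rule pairing_cong, rule tensor_coord_tensor_prod, rule assms(3))
    (use assms(2) length_of_tensor_word[OF assms(1)] in auto)

section \<open>Coordinates detect equality of tensors\<close>

text \<open>
  The expansion of every \<open>x\<close> in the vectors \<open>f\<^sub>i\<close> with coefficients \<open>\<phi>\<^sub>i(x)\<close> is what makes the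
  coordinates determine \<open>x\<close>, and, applied in each tensor slot, what makes them determine tensors.
\<close>

locale coordinate_space = vector_space scale
  for scale :: "'k::field \<Rightarrow> 'v::ab_group_add \<Rightarrow> 'v" +
  fixes I :: "'i set" and \<phi> :: "'i \<Rightarrow> 'v \<Rightarrow> 'k" and f :: "'i \<Rightarrow> 'v"
  assumes finite_index: "finite I"
    and coord_add: "i \<in> I \<Longrightarrow> \<phi> i (x + y) = \<phi> i x + \<phi> i y"
    and coord_scale: "i \<in> I \<Longrightarrow> \<phi> i (scale c x) = c * \<phi> i x"
    and expansion: "x = (\<Sum>i\<in>I. scale (\<phi> i x) (f i))"
begin

lemma eq_by_coords:
  assumes "\<And>i. i \<in> I \<Longrightarrow> \<phi> i x = \<phi> i y"
  shows "x = y"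
  using assms by (subst expansion[of x], subst expansion[of y]) simp

lemma teq_refl: "p \<approx> p"
  by (simp add: tensor_eq_def formal.span_zero)

lemma teq_trans [trans]: "p \<approx> q \<Longrightarrow> q \<approx> r \<Longrightarrow> p \<approx> r"
  unfolding tensor_eq_def using formal.span_add[of "p - q" _ "q - r"] by simp

lemma teq_add: "p \<approx> q \<Longrightarrow> p' \<approx> q' \<Longrightarrow> p + p' \<approx> q + q'"
  unfolding tensor_eq_def using formal.span_add[of "p - q" _ "p' - q'"] by (simp add: add_diff_add)

lemma teq_fscale: "p \<approx> q \<Longrightarrow> fscale c p \<approx> fscale c q"
  unfolding tensor_eq_def using formal.span_scale[of "p - q" _ c]
  by (simp add: formal.scale_right_diff_distrib)

lemma teq_sum: "(\<And>a. a \<in> A \<Longrightarrow> p a \<approx> q a) \<Longrightarrow> (\<Sum>a\<in>A. p a) \<approx> (\<Sum>a\<in>A. q a)"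
  by (induction A rule: infinite_finite_induct) (auto intro: teq_refl teq_add)

lemma pure_add: "pure (us @ (x + y) # vs) \<approx> pure (us @ x # vs) + pure (us @ y # vs)"
  unfolding tensor_eq_def
  by (rule formal.span_base) (force simp: tensor_relations_def algebra_simps)

lemma pure_scale: "pure (us @ scale c x # vs) \<approx> fscale c (pure (us @ x # vs))"
  unfolding tensor_eq_def
  by (rule formal.span_base) (force simp: tensor_relations_def)

lemma pure_sum:
  "pure (us @ (\<Sum>a\<in>A. scale (c a) (x a)) # vs) \<approx> (\<Sum>a\<in>A. fscale (c a) (pure (us @ x a # vs)))"
proof (induction A rule: infinite_finite_induct)
  case (insert a A)
  then show ?case
    by (auto intro: teq_trans[OF pure_add] teq_add pure_scale)
next
  case empty
  show ?case using pure_scale[of us 0 0 vs] by simp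
next
  case (infinite A)
  then show ?case using pure_scale[of us 0 0 vs] by simp
qed

lemma tensor_coord_relation:
  assumes "J \<in> lists I" "r \<in> tensor_relations scale"
  shows "tensor_coord \<phi> J r = 0"
proof -
  have "word_value \<phi> (drop k J) ((x + y) # vs)
      = word_value \<phi> (drop k J) (x # vs) + word_value \<phi> (drop k J) (y # vs)"
    and "word_value \<phi> (drop k J) (scale c x # vs) = c * word_value \<phi> (drop k J) (x # vs)"
    for k x y vs c
  proof -
    have "drop k J \<in> lists I"
      using assms(1) set_drop_subset[of k J] by (auto simp: in_lists_conv_set)
    then show "word_value \<phi> (drop k J) ((x + y) # vs)
        = word_value \<phi> (drop k J) (x # vs) + word_value \<phi> (drop k J) (y # vs)"
      and "word_value \<phi> (drop k J) (scale c x # vs) = c * word_value \<phi> (drop k J) (x # vs)"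
      by (cases "drop k J"; simp add: coord_add coord_scale distrib_right mult.assoc)+
  qed
  then show ?thesis
    using assms(2)
    by (auto simp: tensor_relations_def pairing_diff pairing_fscale word_value_append
        simp del: word_value.simps) (simp_all add: distrib_left mult.left_commute)
qed

lemma tensor_coord_teq:
  assumes "J \<in> lists I" "p \<approx> q"
  shows "tensor_coord \<phi> J p = tensor_coord \<phi> J q"
proof -
  have "p - q \<in> formal.span (tensor_relations scale)"
    using assms(2) by (simp add: tensor_eq_def)
  then have "tensor_coord \<phi> J (p - q) = 0"
    by (induction rule: formal.span_induct_alt)
      (simp_all add: pairing_add pairing_fscale tensor_coord_relation[OF assms(1)])
  then show ?thesis by (simp add: pairing_diff)
qed

text \<open>
  Expanding a word slot by slot. The prefix \<open>us\<close> holds the slots already expanded while the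
  induction proceeds through the others.
\<close>

lemma pure_expansion:
  "pure (us @ w) \<approx> (\<Sum>J | set J \<subseteq> I \<and> length J = length w.
     fscale (word_value \<phi> J w) (pure (us @ map f J)))"
proof (induction w arbitrary: us)
  case Nil
  have "{J. set J \<subseteq> I \<and> J = []} = {[]}" by auto
  then show ?case by (simp add: teq_refl)
next
  case (Cons v w)
  let ?L = "{J. set J \<subseteq> I \<and> length J = length w}"
  have "pure (us @ v # w) \<approx> (\<Sum>i\<in>I. fscale (\<phi> i v) (pure (us @ f i # w)))"
    using pure_sum[of us "\<lambda>i. \<phi> i v" f I w] expansion[of v] by simp
  also have "\<dots> \<approx> (\<Sum>i\<in>I. fscale (\<phi> i v)
      (\<Sum>J\<in>?L. fscale (word_value \<phi> J w) (pure (us @ f i # map f J))))"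
    using Cons.IH[of "us @ [f _]"] by (intro teq_sum teq_fscale) simp
  also have "\<dots> = (\<Sum>i\<in>I. \<Sum>J\<in>?L.
      fscale (word_value \<phi> (i # J) (v # w)) (pure (us @ map f (i # J))))"
    by (simp add: formal.scale_sum_right)
  also have "\<dots> = (\<Sum>(J, i)\<in>?L \<times> I.
      fscale (word_value \<phi> (i # J) (v # w)) (pure (us @ map f (i # J))))"
    by (subst sum.swap) (simp add: sum.cartesian_product)
  also have "\<dots> = (\<Sum>J | set J \<subseteq> I \<and> length J = length (v # w).
     fscale (word_value \<phi> J (v # w)) (pure (us @ map f J)))"
    unfolding length_Cons lists_length_Suc_eq
    by (subst sum.reindex) (auto simp: inj_on_def case_prod_unfold)
  finally show ?case .
qed

text \<open>
  Coordinates respect the congruence because they vanish on the multilinearity relations.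
  Conversely, expanding all words of a representative shows that it is congruent to the
  combination of the words \<open>f\<^bsub>J(1)\<^esub> \<otimes> \<dots> \<otimes> f\<^bsub>J(k)\<^esub>\<close> whose coefficients are its coordinates.
\<close>

theorem teq_iff_coords: "p \<approx> q \<longleftrightarrow> (\<forall>J\<in>lists I. tensor_coord \<phi> J p = tensor_coord \<phi> J q)"
proof
  assume "\<forall>J\<in>lists I. tensor_coord \<phi> J p = tensor_coord \<phi> J q"
  then have 0: "tensor_coord \<phi> J (p - q) = 0" if "set J \<subseteq> I" for J
    using that by (simp add: pairing_diff lists_eq_set)
  define r where "r = p - q"
  \<comment> \<open>A common bound on the degrees lets the expansions of all words run over one finite index
    set, so that the two sums can be interchanged.\<close>
  define N where "N = Max (length ` Poly_Mapping.keys r)"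
  let ?L = "{J. set J \<subseteq> I \<and> length J \<le> N}"
  let ?r = "Poly_Mapping.lookup r"
  have fin: "finite ?L" by (rule finite_lists_length_le[OF finite_index])
  have "r \<approx> (\<Sum>w\<in>Poly_Mapping.keys r. fscale (?r w)
      (\<Sum>J | set J \<subseteq> I \<and> length J = length w. fscale (word_value \<phi> J w) (pure (map f J))))"
    by (subst (1) formal_tensor_expansion[of r])
      (intro teq_sum teq_fscale pure_expansion[of "[]", simplified])
  also have "\<dots> = (\<Sum>w\<in>Poly_Mapping.keys r. fscale (?r w)
      (\<Sum>J\<in>?L. fscale (word_value \<phi> J w) (pure (map f J))))"
  proof (rule sum.cong[OF refl], rule arg_cong[where f = "fscale _"],
      rule sum.mono_neutral_left[OF fin])
    fix w assume "w \<in> Poly_Mapping.keys r"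
    then have "length w \<le> N" by (simp add: N_def)
    then show "{J. set J \<subseteq> I \<and> length J = length w} \<subseteq> ?L" by auto
  qed (simp add: word_value_length)
  also have "\<dots> = (\<Sum>J\<in>?L. fscale (tensor_coord \<phi> J r) (pure (map f J)))"
    by (simp add: formal.scale_sum_right pairing_def formal.scale_sum_left) (rule sum.swap)
  also have "\<dots> = 0"
    by (rule sum.neutral) (simp add: r_def 0)
  finally show "p \<approx> q" by (simp add: tensor_eq_def r_def)
qed (simp add: tensor_coord_teq)

end

section \<open>The weak Hopf algebra of a family of characters\<close>

text \<open>
  The algebra \<open>\<bbbK>\<^sup>I\<close> described through its point evaluations \<open>\<phi>\<^sub>i\<close>, with the coproduct for which
  the point masses are grouplike. Pairing \<open>\<Delta>\<close> with \<open>\<phi>\<^sub>i \<otimes> \<phi>\<^sub>j\<close> expresses this independently of the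
  representatives chosen for the values of \<open>\<Delta>\<close>.
\<close>

locale diagonal_coproduct = coordinate_space scale I \<phi> f
  for scale :: "'k::field \<Rightarrow> 'v::ab_group_add \<Rightarrow> 'v"
    and I :: "'i set" and \<phi> :: "'i \<Rightarrow> 'v \<Rightarrow> 'k" and f :: "'i \<Rightarrow> 'v" +
  fixes mul :: "'v \<Rightarrow> 'v \<Rightarrow> 'v" and one :: 'v
    and \<Delta> :: "'v \<Rightarrow> ('v, 'k) formal_tensor" and \<epsilon> :: "'v \<Rightarrow> 'k"
  assumes coord_mul: "i \<in> I \<Longrightarrow> \<phi> i (mul x y) = \<phi> i x * \<phi> i y"
    and coord_one: "i \<in> I \<Longrightarrow> \<phi> i one = 1"
    and comult_degree: "\<Delta> x \<in> tensors 2"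
    and comult_coord: "i \<in> I \<Longrightarrow> j \<in> I \<Longrightarrow>
      tensor_coord \<phi> [i, j] (\<Delta> x) = (if i = j then \<phi> i x else 0)"
    and counit_coord: "\<epsilon> x = (\<Sum>i\<in>I. \<phi> i x)"
begin

lemma pairing_comult_cong:
  assumes "\<And>x y. g [x, y] = h [x, y]"
  shows "pairing g (\<Delta> x) = pairing h (\<Delta> x)"
proof (rule pairing_cong)
  fix w assume "w \<in> Poly_Mapping.keys (\<Delta> x)"
  then have "length w = 2" by (rule length_of_tensor_word[OF comult_degree])
  then show "g w = h w" using assms by (auto simp: length_Suc_conv numeral_2_eq_2)
qed

lemma pairing_comult:
  assumes "i \<in> I" "j \<in> I"
  shows "pairing (\<lambda>w. \<phi> i (w ! 0) * \<phi> j (w ! 1)) (\<Delta> x) = (if i = j then \<phi> i x else 0)"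
  unfolding comult_coord[OF assms, symmetric] by (rule pairing_comult_cong) simp

lemma tensor_coord_comult:
  assumes "J \<in> lists I"
  shows "tensor_coord \<phi> J (\<Delta> x) = (case J of [i, j] \<Rightarrow> if i = j then \<phi> i x else 0 | _ \<Rightarrow> 0)"
proof (cases "length J = 2")
  case True
  then show ?thesis
    using assms by (auto simp: length_Suc_conv numeral_2_eq_2 comult_coord simp del: word_value.simps)
next
  case False
  then show ?thesis
    using tensor_coord_degree[OF comult_degree False] by (auto split: list.split)
qed

lemma tensor_coord_map_comult:
  assumes "\<And>v. F (pure [v]) \<in> tensors b"
  shows "tensor_coord \<phi> J (map_tensor 1 F G (\<Delta> x)) =
    pairing (\<lambda>w. tensor_coord \<phi> (take b J) (F (pure [w ! 0]))
      * tensor_coord \<phi> (drop b J) (G (pure [w ! 1]))) (\<Delta> x)"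
proof -
  have "F (pure w) \<in> tensors b" if "length w = 1" for w
    using that assms by (auto simp: length_Suc_conv)
  then show ?thesis
    by (subst tensor_coord_map_tensor[OF comult_degree _ , of 1 F b])
      (auto intro: pairing_comult_cong)
qed

lemma comult_op_pure [simp]: "comult_op \<Delta> (pure [v]) = \<Delta> v"
  by (simp add: comult_op_def)

lemma counit_op_pure [simp]: "counit_op \<epsilon> (pure [v]) = Poly_Mapping.single [] (\<epsilon> v)"
  by (simp add: counit_op_def)

lemma single_Nil_in_tensors [simp]: "Poly_Mapping.single [] c \<in> tensors 0"
  by (simp add: tensors_def)

text \<open>
  Both iterated coproducts have the coordinate \<open>\<phi>\<^sub>i(x)\<close> at \<open>(i, i, i)\<close> and \<open>0\<close> elsewhere; this is
  coassociativity.
\<close>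

lemma tensor_coord_double_comult_left:
  assumes "J \<in> lists I"
  shows "tensor_coord \<phi> J (map_tensor 1 (comult_op \<Delta>) id (\<Delta> x)) =
    (case J of [i, j, k] \<Rightarrow> if i = j \<and> j = k then \<phi> i x else 0 | _ \<Rightarrow> 0)"
proof -
  have "tensor_coord \<phi> J (map_tensor 1 (comult_op \<Delta>) id (\<Delta> x)) =
    pairing (\<lambda>w. tensor_coord \<phi> (take 2 J) (\<Delta> (w ! 0)) * word_value \<phi> (drop 2 J) [w ! 1]) (\<Delta> x)"
    by (subst tensor_coord_map_comult[where b = 2]) (simp_all add: comult_degree)
  moreover have "take 2 J \<in> lists I"
    using assms set_take_subset[of 2 J] by (auto simp: in_lists_conv_set)
  ultimately show ?thesis
    using assms
    by (auto simp: tensor_coord_comult pairing_comult[simplified] pairing_if_times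
        numeral_2_eq_2 split: list.split)
qed

lemma tensor_coord_double_comult_right:
  assumes "J \<in> lists I"
  shows "tensor_coord \<phi> J (map_tensor 1 id (comult_op \<Delta>) (\<Delta> x)) =
    (case J of [i, j, k] \<Rightarrow> if i = j \<and> j = k then \<phi> i x else 0 | _ \<Rightarrow> 0)"
proof -
  have "tensor_coord \<phi> J (map_tensor 1 id (comult_op \<Delta>) (\<Delta> x)) =
    pairing (\<lambda>w. word_value \<phi> (take 1 J) [w ! 0] * tensor_coord \<phi> (drop 1 J) (\<Delta> (w ! 1))) (\<Delta> x)"
    by (subst tensor_coord_map_comult[where b = 1]) simp_all
  moreover have "drop 1 J \<in> lists I"
    using assms set_drop_subset[of 1 J] by (auto simp: in_lists_conv_set)
  ultimately show ?thesis
    using assms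
    by (auto simp: tensor_coord_comult pairing_comult[simplified] pairing_if_times
        split: list.split)
qed

lemma tensor_coord_counit_left:
  assumes "p \<in> tensors 2"
  shows "tensor_coord \<phi> J (map_tensor 1 (counit_op \<epsilon>) id p) =
    (case J of [j] \<Rightarrow> \<Sum>i\<in>I. tensor_coord \<phi> [i, j] p | _ \<Rightarrow> 0)"
proof -
  have "tensor_coord \<phi> J (map_tensor 1 (counit_op \<epsilon>) id p) =
    pairing (\<lambda>w. case J of [j] \<Rightarrow> \<Sum>i\<in>I. word_value \<phi> [i, j] w | _ \<Rightarrow> 0) p"
    unfolding map_tensor_def pairing_lin_ext
  proof (rule pairing_cong)
    fix w assume "w \<in> Poly_Mapping.keys p"
    then have "length w = 2" by (rule length_of_tensor_word[OF assms])
    then obtain x y where "w = [x, y]"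
      by (auto simp: length_Suc_conv numeral_2_eq_2)
    then show "tensor_coord \<phi> J (counit_op \<epsilon> (pure (take 1 w)) \<otimes> id (pure (drop 1 w))) =
        (case J of [j] \<Rightarrow> \<Sum>i\<in>I. word_value \<phi> [i, j] w | _ \<Rightarrow> 0)"
      by (simp add: tensor_coord_tensor_prod[where a = 0] counit_coord sum_distrib_right
          split: list.split)
  qed
  then show ?thesis by (simp add: pairing_sum_functional split: list.split)
qed

lemma tensor_coord_counit_right:
  assumes "p \<in> tensors 2"
  shows "tensor_coord \<phi> J (map_tensor 1 id (counit_op \<epsilon>) p) =
    (case J of [i] \<Rightarrow> \<Sum>j\<in>I. tensor_coord \<phi> [i, j] p | _ \<Rightarrow> 0)"
proof -
  have "tensor_coord \<phi> J (map_tensor 1 id (counit_op \<epsilon>) p) =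
    pairing (\<lambda>w. case J of [i] \<Rightarrow> \<Sum>j\<in>I. word_value \<phi> [i, j] w | _ \<Rightarrow> 0) p"
    unfolding map_tensor_def pairing_lin_ext
  proof (rule pairing_cong)
    fix w assume "w \<in> Poly_Mapping.keys p"
    then have "length w = 2" by (rule length_of_tensor_word[OF assms])
    then obtain x y where "w = [x, y]"
      by (auto simp: length_Suc_conv numeral_2_eq_2)
    then show "tensor_coord \<phi> J (id (pure (take 1 w)) \<otimes> counit_op \<epsilon> (pure (drop 1 w))) =
        (case J of [i] \<Rightarrow> \<Sum>j\<in>I. word_value \<phi> [i, j] w | _ \<Rightarrow> 0)"
      by (simp add: tensor_coord_tensor_prod[where a = 1] counit_coord sum_distrib_left
          split: list.split)
  qed
  then show ?thesis by (simp add: pairing_sum_functional split: list.split)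
qed

lemma tensor_coord_mul:
  "J \<in> lists I \<Longrightarrow> p \<in> tensors k \<Longrightarrow> q \<in> tensors k \<Longrightarrow>
    tensor_coord \<phi> J (cw_mult mul p q) = tensor_coord \<phi> J p * tensor_coord \<phi> J q"
  by (rule tensor_coord_cw_mult) (auto simp: coord_mul in_lists_conv_set)

lemma tensor_coord_mult:
  "J \<in> lists I \<Longrightarrow> p \<in> tensors 2 \<Longrightarrow>
    tensor_coord \<phi> J (mult_op mul p) = (case J of [i] \<Rightarrow> tensor_coord \<phi> [i, i] p | _ \<Rightarrow> 0)"
  by (rule tensor_coord_mult_op) (auto simp: coord_mul in_lists_conv_set)

lemma double_comult_degree: "map_tensor 1 (comult_op \<Delta>) id (\<Delta> x) \<in> tensors 3"
proof -
  have "map_tensor 1 (comult_op \<Delta>) id (\<Delta> x) \<in> tensors (2 + 1)"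
    by (rule map_tensor_in_tensors[OF comult_degree])
      (auto simp: length_Suc_conv comult_degree)
  then show ?thesis by simp
qed

text \<open>
  With \<open>S = id\<close> the last antipode axiom says that multiplying the three factors of the iterated
  coproduct gives back \<open>x\<close>: multiplication restricts coordinates to the diagonal, and that is where
  the iterated coproduct is supported.
\<close>

lemma tensor_coord_triple_product:
  assumes "J \<in> lists I"
  shows "tensor_coord \<phi> J (mult_op mul (map_tensor 2 (mult_op mul) id
      (map_tensor 1 (endo_op id) (map_tensor 1 id (endo_op id))
        (map_tensor 1 (comult_op \<Delta>) id (\<Delta> x))))) = (case J of [i] \<Rightarrow> \<phi> i x | _ \<Rightarrow> 0)"
proof -
  define Q where "Q = map_tensor 1 (comult_op \<Delta>) id (\<Delta> x)"
  define R where "R = map_tensor 2 (mult_op mul) id Q"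
  have Q: "Q \<in> tensors 3"
    unfolding Q_def by (rule double_comult_degree)
  have mult_pure: "mult_op mul (pure w) \<in> tensors 1" for w
    by (simp add: mult_op_def)
  have "R \<in> tensors (1 + 1)"
    unfolding R_def by (rule map_tensor_in_tensors[OF Q, where b = 1], simp, rule mult_pure, simp)
  then have R: "R \<in> tensors 2" by (simp only: one_add_one)
  have coord_R: "tensor_coord \<phi> [i, i] R = \<phi> i x" if "i \<in> I" for i
  proof -
    have "tensor_coord \<phi> [i, i] R =
        pairing (\<lambda>w. tensor_coord \<phi> (take 1 [i, i]) (mult_op mul (pure (take 2 w)))
          * tensor_coord \<phi> (drop 1 [i, i]) (id (pure (drop 2 w)))) Q"
      unfolding R_def by (rule tensor_coord_map_tensor[OF Q], simp, rule mult_pure)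
    also have "\<dots> = tensor_coord \<phi> [i, i, i] Q"
    proof (rule pairing_cong)
      fix w assume "w \<in> Poly_Mapping.keys Q"
      then have "length w = 3" by (rule length_of_tensor_word[OF Q])
      then obtain a b c where "w = [a, b, c]"
        by (auto simp: length_Suc_conv numeral_3_eq_3)
      then show "tensor_coord \<phi> (take 1 [i, i]) (mult_op mul (pure (take 2 w)))
          * tensor_coord \<phi> (drop 1 [i, i]) (id (pure (drop 2 w))) = word_value \<phi> [i, i, i] w"
        using that by (simp add: mult_op_def coord_mul)
    qed
    also have "\<dots> = \<phi> i x"
      unfolding Q_def by (subst tensor_coord_double_comult_left) (use that in simp_all)
    finally show ?thesis .
  qed
  show ?thesis
    unfolding Q_def[symmetric] map_tensor_endo_id3[OF Q] R_def[symmetric]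
      tensor_coord_mult[OF assms R]
    using assms coord_R by (auto split: list.split)
qed

text \<open>
  All coordinates of \<open>1\<close> are \<open>1\<close>, so the coordinate at \<open>(i, j, k)\<close> of either product is \<open>1\<close> exactly
  when \<open>i = j\<close> and \<open>j = k\<close>; the order of the factors is immaterial because coordinates are scalars.
\<close>

lemma tensor_coord_delta_one:
  assumes "J \<in> lists I"
  shows "tensor_coord \<phi> J (cw_mult mul (\<Delta> one \<otimes> pure [one]) (pure [one] \<otimes> \<Delta> one)) =
      tensor_coord \<phi> J (map_tensor 1 (comult_op \<Delta>) id (\<Delta> one))"
    and "tensor_coord \<phi> J (cw_mult mul (pure [one] \<otimes> \<Delta> one) (\<Delta> one \<otimes> pure [one])) =
      tensor_coord \<phi> J (map_tensor 1 (comult_op \<Delta>) id (\<Delta> one))"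
proof -
  have deg: "\<Delta> one \<otimes> pure [one] \<in> tensors 3" "pure [one] \<otimes> \<Delta> one \<in> tensors 3"
    using tensor_prod_in_tensors[OF comult_degree[of one], of "pure [one]" 1]
      tensor_prod_in_tensors[of "pure [one]" 1, OF _ comult_degree[of one]]
    by (simp_all add: eval_nat_numeral)
  have "tensor_coord \<phi> J (\<Delta> one \<otimes> pure [one]) * tensor_coord \<phi> J (pure [one] \<otimes> \<Delta> one) =
      tensor_coord \<phi> J (map_tensor 1 (comult_op \<Delta>) id (\<Delta> one))"
  proof (cases "length J = 3")
    case True
    then obtain i j k where "J = [i, j, k]"
      by (auto simp: length_Suc_conv numeral_3_eq_3)
    then show ?thesis
      unfolding tensor_coord_double_comult_left[OF assms]
      using assms
      by (simp add: tensor_coord_comult coord_one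
          tensor_coord_tensor_prod[OF comult_degree] tensor_coord_tensor_prod[where a = 1])
  next
    case False
    then show ?thesis
      by (simp add: tensor_coord_degree[OF deg(1)] tensor_coord_degree[OF double_comult_degree]
          del: One_nat_def)
  qed
  then show "tensor_coord \<phi> J (cw_mult mul (\<Delta> one \<otimes> pure [one]) (pure [one] \<otimes> \<Delta> one)) =
      tensor_coord \<phi> J (map_tensor 1 (comult_op \<Delta>) id (\<Delta> one))"
    and "tensor_coord \<phi> J (cw_mult mul (pure [one] \<otimes> \<Delta> one) (\<Delta> one \<otimes> pure [one])) =
      tensor_coord \<phi> J (map_tensor 1 (comult_op \<Delta>) id (\<Delta> one))"
    by (simp_all add: tensor_coord_mul[OF assms deg] tensor_coord_mul[OF assms deg(2) deg(1)]
        mult.commute)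
qed

text \<open>
  Writing \<open>\<epsilon>\<close> as the sum of the characters turns the right-hand side into a double sum over
  \<open>i, j\<close>, of which \<open>\<Delta>(y)\<close> keeps the diagonal terms \<open>\<phi>\<^sub>i(x) \<phi>\<^sub>i(y) \<phi>\<^sub>i(z)\<close>.
\<close>

lemma counit_weakly_multiplicative:
  "\<epsilon> (mul (mul x y) z) =
    pairing (\<lambda>w. \<epsilon> (mul x (w ! 0)) * \<epsilon> (mul (w ! 1) z)) (\<Delta> y)"
proof -
  have "pairing (\<lambda>w. \<epsilon> (mul x (w ! 0)) * \<epsilon> (mul (w ! 1) z)) (\<Delta> y) =
    pairing (\<lambda>w. \<Sum>i\<in>I. \<Sum>j\<in>I. (\<phi> i x * \<phi> j z) * (\<phi> i (w ! 0) * \<phi> j (w ! 1))) (\<Delta> y)"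
    by (rule pairing_cong) (simp add: counit_coord coord_mul sum_product ac_simps)
  also have "\<dots> = (\<Sum>i\<in>I. \<Sum>j\<in>I. (\<phi> i x * \<phi> j z) * (if i = j then \<phi> i y else 0))"
    by (simp add: pairing_sum_functional pairing_times_left pairing_comult[simplified])
  also have "\<dots> = \<epsilon> (mul (mul x y) z)"
    by (simp add: counit_coord coord_mul if_distrib finite_index ac_simps cong: if_cong)
  finally show ?thesis by simp
qed

theorem diagonal_coproduct_weak_hopf_algebra: "weak_hopf_algebra scale mul (\<lambda>c. scale c one) \<Delta> \<epsilon> id"
proof -
  have scale_field: "vector_space ((*) :: 'k \<Rightarrow> 'k \<Rightarrow> 'k)"
    by unfold_locales (simp_all add: algebra_simps)
  have linI: "Vector_Spaces.linear s1 s2 g"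
    if "vector_space s1" "vector_space s2" "\<And>x y. g (x + y) = g x + g y" "\<And>c x. g (s1 c x) = s2 c (g x)"
    for s1 :: "'k \<Rightarrow> 'x::ab_group_add \<Rightarrow> 'x" and s2 :: "'k \<Rightarrow> 'y::ab_group_add \<Rightarrow> 'y" and g
    using that by (simp add: Vector_Spaces.linear_def module_hom_def module_hom_axioms_def
        module_iff_vector_space)
  show ?thesis
  proof (intro weak_hopf_algebra.intro weak_hopf_algebra_axioms.intro weak_bialgebra.intro
      weak_bialgebra_axioms.intro unital_algebra.intro unital_algebra_axioms.intro
      coalgebra.intro coalgebra_axioms.intro vector_space_axioms)
    show "Vector_Spaces.linear scale scale (mul x)" "Vector_Spaces.linear scale scale (\<lambda>x. mul x y)"
      for x y
      by (intro linI vector_space_axioms eq_by_coords;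
          simp add: coord_mul coord_add coord_scale algebra_simps)+
    show "mul (mul x y) z = mul x (mul y z)" for x y z
      by (rule eq_by_coords) (simp add: coord_mul)
    show "mul (scale 1 one) x = x" "mul x (scale 1 one) = x" for x
      by (rule eq_by_coords, simp add: coord_mul coord_one)+
    show "linear_to_tensors scale 2 \<Delta>"
      unfolding linear_to_tensors_def
      by (auto simp: comult_degree teq_iff_coords tensor_coord_comult pairing_add pairing_fscale
          coord_add coord_scale split: list.split)
    show "Vector_Spaces.linear scale (*) \<epsilon>"
      by (intro linI vector_space_axioms scale_field)
        (simp_all add: counit_coord coord_add coord_scale sum.distrib sum_distrib_left)
    show "map_tensor 1 (comult_op \<Delta>) id (\<Delta> x) \<approx> map_tensor 1 id (comult_op \<Delta>) (\<Delta> x)" for x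
      by (simp add: teq_iff_coords tensor_coord_double_comult_left tensor_coord_double_comult_right
          del: One_nat_def)
    show "map_tensor 1 (counit_op \<epsilon>) id (\<Delta> x) \<approx> pure [x]"
      and "map_tensor 1 id (counit_op \<epsilon>) (\<Delta> x) \<approx> pure [x]" for x
      by (auto simp: teq_iff_coords tensor_coord_counit_left tensor_coord_counit_right comult_degree
          comult_coord finite_index simp del: One_nat_def split: list.split)
    show "Vector_Spaces.linear (*) scale (\<lambda>c. scale c one)"
      by (intro linI vector_space_axioms scale_field) (simp_all add: scale_left_distrib)
    show "\<Delta> (mul x y) \<approx> cw_mult mul (\<Delta> x) (\<Delta> y)" for x y
      by (auto simp: teq_iff_coords tensor_coord_mul[where k = 2] comult_degree
          tensor_coord_comult coord_mul
          split: list.split)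
    show "map_tensor 1 (comult_op \<Delta>) id (\<Delta> (scale 1 one)) \<approx>
        cw_mult mul (\<Delta> (scale 1 one) \<otimes> pure [scale 1 one]) (pure [scale 1 one] \<otimes> \<Delta> (scale 1 one))"
      by (simp add: teq_iff_coords tensor_coord_delta_one del: One_nat_def)
    show "map_tensor 1 (comult_op \<Delta>) id (\<Delta> (scale 1 one)) \<approx>
        cw_mult mul (pure [scale 1 one] \<otimes> \<Delta> (scale 1 one)) (\<Delta> (scale 1 one) \<otimes> pure [scale 1 one])"
      by (simp add: teq_iff_coords tensor_coord_delta_one del: One_nat_def)
    show "\<epsilon> (mul (mul x y) z) = (\<Sum>w\<in>Poly_Mapping.keys (\<Delta> y).
        Poly_Mapping.lookup (\<Delta> y) w * (\<epsilon> (mul x (w ! 0)) * \<epsilon> (mul (w ! 1) z)))" for x y z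
      using counit_weakly_multiplicative[of x y z] by (simp add: pairing_def)
    show "Vector_Spaces.linear scale scale id"
      by (intro linI vector_space_axioms) simp_all
    show "mult_op mul (map_tensor 1 id (endo_op id) (\<Delta> x)) \<approx>
        map_tensor 1 (counit_op \<epsilon>) id
          (cw_mult mul (\<Delta> (scale 1 one)) (pure [x] \<otimes> pure [scale 1 one]))"
      and "mult_op mul (map_tensor 1 (endo_op id) id (\<Delta> x)) \<approx>
        map_tensor 1 id (counit_op \<epsilon>)
          (cw_mult mul (pure [scale 1 one] \<otimes> pure [x]) (\<Delta> (scale 1 one)))" for x
      by (auto simp: teq_iff_coords map_tensor_endo_id comult_degree tensor_coord_mult
          tensor_coord_counit_left tensor_coord_counit_right cw_mult_in_tensors tensor_coord_mul[where k = 2]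
          comult_coord coord_one finite_index if_distrib if_distribR
          simp del: One_nat_def cong: if_cong split: list.split)
    show "mult_op mul (map_tensor 2 (mult_op mul) id
        (map_tensor 1 (endo_op id) (map_tensor 1 id (endo_op id))
          (map_tensor 1 (comult_op \<Delta>) id (\<Delta> x)))) \<approx> pure [id x]" for x
      by (auto simp: teq_iff_coords tensor_coord_triple_product simp del: One_nat_def
          split: list.split)
  qed
qed

end

section \<open>The max-multiplication with an adjoined unit\<close>

lemma vector_space_adjoin_scale:
  assumes "vector_space scale"
  shows "vector_space (adjoin_scale scale)"
proof -
  interpret vector_space scale by fact
  show ?thesis
    by unfold_locales
      (auto simp: adjoin_scale_def plus_prod_def algebra_simps)
qed

lemma adjoin_basis_induct:
  assumes "module.span scale (e ` {2..n}) = UNIV" "vector_space scale" "1 \<le> n"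
    and add: "\<And>x y. P x \<Longrightarrow> P y \<Longrightarrow> P (x + y)"
    and scale: "\<And>c x. P x \<Longrightarrow> P (adjoin_scale scale c x)"
    and basis: "\<And>j. j \<in> {1..n} \<Longrightarrow> P (adjoin_basis e j)"
  shows "P (x :: 'a::ab_group_add \<times> 'k::field)"
proof -
  interpret vector_space scale by fact
  have one: "P (0, \<alpha>)" for \<alpha>
    using scale[OF basis[of 1], of \<alpha>] assms(3)
    by (simp add: adjoin_scale_def adjoin_basis_def)
  have "a \<in> span (e ` {2..n})" for a
    using assms(1) by simp
  then have "P (a, 0)" for a
  proof (induction a rule: span_induct_alt[consumes 1])
    case base
    show ?case by (rule one)
  next
    case (step c b a)
    then obtain j where "j \<in> {2..n}" "b = e j" by auto
    then have "P (adjoin_scale scale c (b, 0))"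
      using scale[OF basis[of j], of c] by (auto simp: adjoin_basis_def)
    from add[OF this step(2)] show ?case
      by (simp add: adjoin_scale_def)
  qed
  from add[OF this[of "fst x"] one[of "snd x"]] show ?thesis by simp
qed

text \<open>
  The linear functional that takes the value \<open>1\<close> on \<open>e\<^sub>2, \<dots>, e\<^sub>i\<close> and \<open>0\<close> on the later basis vectors.
\<close>

definition initial_coord_sum ::
  "('k::field \<Rightarrow> 'a::ab_group_add \<Rightarrow> 'a) \<Rightarrow> (nat \<Rightarrow> 'a) \<Rightarrow> nat \<Rightarrow> nat \<Rightarrow> 'a \<Rightarrow> 'k" where
  "initial_coord_sum scale e n i x =
     (\<Sum>k | k \<in> {2..n} \<and> k \<le> i. module.representation scale (e ` {2..n}) x (e k))"

text \<open>
  Since \<open>max j k \<le> i\<close> holds exactly when \<open>j \<le> i\<close> and \<open>k \<le> i\<close>, the indicator of \<open>{j. j \<le> i}\<close> is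
  multiplicative on the basis, and its linear extension is multiplicative on the algebra.
\<close>

lemma max_basis_characters:
  fixes scale :: "'k::field \<Rightarrow> 'a::ab_group_add \<Rightarrow> 'a"
    and e :: "nat \<Rightarrow> 'a" and n :: nat
  defines "\<psi> \<equiv> initial_coord_sum scale e n"
  assumes "unital_algebra scale mul u"
    and inj: "inj_on e {2..n}"
    and indep: "\<not> module.dependent scale (e ` {2..n})"
    and span: "module.span scale (e ` {2..n}) = UNIV"
    and mul_e: "\<And>i j. i \<in> {2..n} \<Longrightarrow> j \<in> {2..n} \<Longrightarrow> mul (e i) (e j) = e (max i j)"
  shows "\<psi> i (x + y) = \<psi> i x + \<psi> i y"
    and "\<psi> i (scale c x) = c * \<psi> i x"
    and "j \<in> {2..n} \<Longrightarrow> \<psi> i (e j) = (if j \<le> i then 1 else 0)"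
    and "\<psi> i (mul x y) = \<psi> i x * \<psi> i y"
proof -
  interpret unital_algebra scale mul u by fact
  let ?B = "e ` {2..n}"
  have spanned: "x \<in> span ?B" for x using span by simp
  have \<psi>_eq: "\<psi> i x = (\<Sum>k | k \<in> {2..n} \<and> k \<le> i. representation ?B x (e k))" for i x
    by (simp add: \<psi>_def initial_coord_sum_def)
  have add: "\<psi> i (x + y) = \<psi> i x + \<psi> i y" for i x y
    by (simp add: \<psi>_eq representation_add[OF indep spanned spanned] sum.distrib)
  have scale: "\<psi> i (scale c x) = c * \<psi> i x" for i c x
    by (simp add: \<psi>_eq representation_scale[OF indep spanned] sum_distrib_left)
  have basis: "\<psi> i (e j) = (if j \<le> i then 1 else 0)" if "j \<in> {2..n}" for i j
  proof -
    have "\<psi> i (e j) = (\<Sum>k | k \<in> {2..n} \<and> k \<le> i. if k = j then 1 else 0)"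
      unfolding \<psi>_eq
    proof (rule sum.cong)
      fix k assume "k \<in> {k. k \<in> {2..n} \<and> k \<le> i}"
      then show "representation ?B (e j) (e k) = (if k = j then 1 else 0)"
        using that inj by (auto simp: representation_basis[OF indep] inj_on_eq_iff)
    qed simp
    also have "\<dots> = (if j \<le> i then 1 else 0)"
      using that by simp
    finally show ?thesis .
  qed
  have zero: "\<psi> i 0 = 0" for i using scale[of i 0 0] by simp
  interpret L: Vector_Spaces.linear scale scale "\<lambda>x. mul x y" for y
    by (rule mult_linear_left)
  interpret R: Vector_Spaces.linear scale scale "\<lambda>y. mul x y" for x
    by (rule mult_linear_right)
  have mult_e: "\<psi> i (mul (e j) y) = \<psi> i (e j) * \<psi> i y" if "j \<in> {2..n}" for i j y
    using spanned[of y]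
  proof (induction y rule: span_induct_alt[consumes 1])
    case (step c b y)
    then obtain k where k: "k \<in> {2..n}" "b = e k" by auto
    then have "max j k \<in> {2..n}" using that by auto
    then show ?case
      using step.IH that k by (simp add: R.add R.scale add scale basis mul_e algebra_simps)
  qed (simp add: zero)
  have "\<psi> i (mul x y) = \<psi> i x * \<psi> i y" for i x y
    using spanned[of x]
  proof (induction x rule: span_induct_alt[consumes 1])
    case (step c b x)
    then show ?case by (auto simp: L.add L.scale add scale mult_e algebra_simps)
  qed (simp add: zero)
  with add scale basis
  show "\<psi> i (x + y) = \<psi> i x + \<psi> i y"
    and "\<psi> i (scale c x) = c * \<psi> i x"
    and "j \<in> {2..n} \<Longrightarrow> \<psi> i (e j) = (if j \<le> i then 1 else 0)"
    and "\<psi> i (mul x y) = \<psi> i x * \<psi> i y"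
    by blast+
qed

theorem proposition2p8:
  fixes scale :: "'k::{alg_closed_field, field_char_0} \<Rightarrow> 'a::ab_group_add \<Rightarrow> 'a"
    and mul :: "'a \<Rightarrow> 'a \<Rightarrow> 'a"
    and e :: "nat \<Rightarrow> 'a"
    and n :: nat
    and \<Delta> :: "'a \<times> 'k \<Rightarrow> ('a \<times> 'k, 'k) formal_tensor"
    and \<epsilon> :: "'a \<times> 'k \<Rightarrow> 'k"
  assumes "n \<ge> 2"
    and "unital_algebra scale mul (e 2)"
    and "inj_on e {2..n}"
    and "\<not> module.dependent scale (e ` {2..n})"
    and "module.span scale (e ` {2..n}) = UNIV"
    and "\<And>i j. i \<in> {2..n} \<Longrightarrow> j \<in> {2..n} \<Longrightarrow> mul (e i) (e j) = e (max i j)"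
    and "linear_to_tensors (adjoin_scale scale) 2 \<Delta>"
    and "tensor_eq (adjoin_scale scale) (\<Delta> (adjoin_basis e n))
           (pure [adjoin_basis e n] \<otimes> pure [adjoin_basis e n])"
    and "\<And>i. i \<in> {1..n - 1} \<Longrightarrow>
           tensor_eq (adjoin_scale scale) (\<Delta> (adjoin_basis e i))
             (pure [adjoin_basis e i - adjoin_basis e (i + 1)]
                \<otimes> pure [adjoin_basis e i - adjoin_basis e (i + 1)]
              + \<Delta> (adjoin_basis e (i + 1)))"
    and "Vector_Spaces.linear (adjoin_scale scale) (*) \<epsilon>"
    and "\<And>i. i \<in> {1..n} \<Longrightarrow> \<epsilon> (adjoin_basis e i) = of_nat (n - i + 1)"
  shows "weak_hopf_algebra (adjoin_scale scale) (adjoin_mult scale mul)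
           (\<lambda>c. adjoin_scale scale c (adjoin_basis e 1)) \<Delta> \<epsilon> id"
proof -
  interpret A: unital_algebra scale mul "e 2" by fact
  interpret B: vector_space "adjoin_scale scale"
    by (rule vector_space_adjoin_scale) (rule A.vector_space_axioms)
  let ?\<psi> = "initial_coord_sum scale e n"
  have \<psi>: "?\<psi> i (x + y) = ?\<psi> i x + ?\<psi> i y" "?\<psi> i (scale c x) = c * ?\<psi> i x"
    "?\<psi> i (mul x y) = ?\<psi> i x * ?\<psi> i y" for i c x y
    by (rule max_basis_characters[OF assms(2-5)], rule assms(6), assumption+)+
  have \<psi>_e: "?\<psi> i (e j) = (if j \<le> i then 1 else 0)" if "j \<in> {2..n}" for i j
    by (rule max_basis_characters(3)[OF assms(2-5) _ that], rule assms(6))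
  let ?E = "adjoin_basis e :: nat \<Rightarrow> 'a \<times> 'k"
  \<comment> \<open>The characters extend to the algebra with adjoined unit by sending the new unit to \<open>1\<close>.
    The one with index \<open>1\<close> vanishes on the original algebra, so \<open>\<phi>\<^sub>1\<close> is the projection onto the
    new unit.\<close>
  define \<phi> where "\<phi> i x = ?\<psi> i (fst x) + snd x" for i and x :: "'a \<times> 'k"
  define f where "f i = (if i = n then ?E n else ?E i - ?E (i + 1))" for i
  have induct: "P x" if "\<And>x y. P x \<Longrightarrow> P y \<Longrightarrow> P (x + y)"
      "\<And>c x. P x \<Longrightarrow> P (adjoin_scale scale c x)" "\<And>j. j \<in> {1..n} \<Longrightarrow> P (?E j)"
    for P :: "'a \<times> 'k \<Rightarrow> bool" and x
  proof (rule adjoin_basis_induct[where P = P, OF assms(5) A.vector_space_axioms])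
    show "1 \<le> n" using assms(1) by simp
  qed (use that in blast)+
  have \<phi>_add: "\<phi> i (x + y) = \<phi> i x + \<phi> i y" for i x y
    by (simp add: \<phi>_def \<psi>)
  have \<phi>_scale: "\<phi> i (adjoin_scale scale c x) = c * \<phi> i x" for i c x
    by (simp add: \<phi>_def \<psi> adjoin_scale_def case_prod_unfold distrib_left)
  have \<phi>_mult: "\<phi> i (adjoin_mult scale mul x y) = \<phi> i x * \<phi> i y" for i x y
    by (simp add: \<phi>_def \<psi> adjoin_mult_def case_prod_unfold algebra_simps)
  have \<phi>_diff: "\<phi> i (x - y) = \<phi> i x - \<phi> i y" for i x y
    using \<phi>_add[of i "x - y" y] by (simp add: algebra_simps)
  have \<phi>_E: "\<phi> i (?E j) = (if j \<le> i then 1 else 0)" if "i \<in> {1..n}" "j \<in> {1..n}" for i j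
    using that \<psi>(2)[of i 0 0] \<psi>_e[of j i] by (auto simp: \<phi>_def adjoin_basis_def)
  \<comment> \<open>Because \<open>\<phi>\<^sub>i(e\<^sub>j)\<close> is \<open>1\<close> for \<open>i \<ge> j\<close> and \<open>0\<close> otherwise, this is the coordinate expansion
    of \<open>e\<^sub>j\<close>.\<close>
  have telescope: "(\<Sum>i=j..n. f i) = ?E j" if "j \<le> n" for j
    using that
  proof (induction j rule: inc_induct)
    case (step j)
    then show ?case by (simp add: sum.atLeast_Suc_atMost f_def)
  qed (simp add: f_def)
  have expansion: "x = (\<Sum>i\<in>{1..n}. adjoin_scale scale (\<phi> i x) (f i))" for x
  proof (induction x rule: induct)
    case (1 x y)
    then show ?case by (simp add: \<phi>_add B.scale_left_distrib sum.distrib)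
  next
    case (2 c x)
    then show ?case
      by (simp add: \<phi>_scale B.scale_sum_right[symmetric] flip: B.scale_scale)
  next
    case (3 j)
    have "(\<Sum>i\<in>{1..n}. adjoin_scale scale (\<phi> i (?E j)) (f i)) = (\<Sum>i=j..n. f i)"
      by (rule sum.mono_neutral_cong_right) (use 3 in \<open>auto simp: \<phi>_E\<close>)
    then show ?case using telescope 3 by simp
  qed
  interpret coordinate_space "adjoin_scale scale" "{1..n}" \<phi> f
    by unfold_locales (simp, rule \<phi>_add, rule \<phi>_scale, rule expansion)
  \<comment> \<open>Descending induction along the recursion for \<open>\<Delta>\<close>: the step from \<open>j + 1\<close> to \<open>j\<close> adds
    \<open>f\<^sub>j \<otimes> f\<^sub>j\<close>, which contributes exactly at \<open>a = b = j\<close>.\<close>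
  have comult_E: "tensor_coord \<phi> [a, b] (\<Delta> (?E j)) = (if a = b then \<phi> a (?E j) else 0)"
    if "a \<in> {1..n}" "b \<in> {1..n}" "j \<in> {1..n}" for a b j
  proof -
    have ab: "[a, b] \<in> lists {1..n}" using that by simp
    have "j \<le> n" "1 \<le> j" using that by auto
    then show ?thesis
    proof (induction j rule: inc_induct)
      case base
      show ?case
        using tensor_coord_teq[OF ab assms(8)] that by (auto simp: \<phi>_E)
    next
      case (step j)
      then have "j \<in> {1..n - 1}" by auto
      from tensor_coord_teq[OF ab assms(9)[OF this]] step that show ?case
        by (auto simp: \<phi>_E \<phi>_diff pairing_add)
    qed
  qed
  have \<Delta>_add: "tensor_eq (adjoin_scale scale) (\<Delta> (x + y)) (\<Delta> x + \<Delta> y)"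
    and \<Delta>_scale: "tensor_eq (adjoin_scale scale) (\<Delta> (adjoin_scale scale c x)) (fscale c (\<Delta> x))"
    and \<Delta>_deg: "\<Delta> x \<in> tensors 2" for c x y
    using assms(7) unfolding linear_to_tensors_def by blast+
  have comult: "tensor_coord \<phi> [a, b] (\<Delta> x) = (if a = b then \<phi> a x else 0)"
    if "a \<in> {1..n}" "b \<in> {1..n}" for a b x
  proof -
    have ab: "[a, b] \<in> lists {1..n}" using that by simp
    show ?thesis
    proof (induction x rule: induct)
      case (1 x y)
      then show ?case by (simp add: tensor_coord_teq[OF ab \<Delta>_add] pairing_add \<phi>_add)
    next
      case (2 c x)
      then show ?case by (simp add: tensor_coord_teq[OF ab \<Delta>_scale] pairing_fscale \<phi>_scale)
    qed (rule comult_E[OF that])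
  qed
  interpret \<epsilon>: Vector_Spaces.linear "adjoin_scale scale" "(*)" \<epsilon> by fact
  have counit: "\<epsilon> x = (\<Sum>i\<in>{1..n}. \<phi> i x)" for x
  proof (induction x rule: induct)
    case (3 j)
    have "(\<Sum>i\<in>{1..n}. \<phi> i (?E j)) = (\<Sum>i=j..n. 1)"
      by (rule sum.mono_neutral_cong_right) (use 3 in \<open>auto simp: \<phi>_E\<close>)
    then show ?case using assms(11)[OF 3] 3 by (simp add: Suc_diff_le)
  qed (simp_all add: \<epsilon>.add \<epsilon>.scale \<phi>_add \<phi>_scale sum.distrib sum_distrib_left)
  interpret diagonal_coproduct "adjoin_scale scale" "{1..n}" \<phi> f "adjoin_mult scale mul" "?E 1" \<Delta> \<epsilon>
    by unfold_locales (use assms(1) in \<open>simp_all add: \<phi>_mult \<phi>_E \<Delta>_deg comult counit\<close>)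
  show ?thesis by (rule diagonal_coproduct_weak_hopf_algebra)
qed

end
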